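(* Let $\Lambda$ be an Artin algebra and let $(N\xrightarrow{g}M)$ be an object in $\mathcal{H}(\Lambda)$. Let $P_1\xrightarrow{f}P_0\xrightarrow{\sigma}M\to 0$ be a projective presentation of $M$ and let $e:Q\to N$ be an epimorphism with $Q$ a projective module. Let $U$ be the pullback of $g$ along $\sigma$, with projections $h:U\to N$ and $d:U\to P_0$ (so $\sigma d=gh$), and let $e':Q\to U$ be a lifting of $e$, i.e. $he'=e$. Then $$\left([0\ \ e],\ \sigma\right):\left(P_1\oplus Q\xrightarrow{[f\ \ de']}P_0\right)\to\left(N\xrightarrow{g}M\right)$$ is a right $\mathcal{P}(\Lambda)$-approximation.
   Context: $\mathrm{mod}\text{-}\Lambda$ is the category of finitely generated $\Lambda$-modules. $\mathcal{H}(\Lambda)$ is the morphism category of $\mathrm{mod}\text{-}\Lambda$: objects are morphisms $f:X\to Y$ in $\mathrm{mod}\text{-}\Lambda$, and a morphism from $(X\xrightarrow{f}Y)$ to $(X'\xrightarrow{f'}Y')$ is a pair $(\sigma_1,\sigma_2)$ with $\sigma_1:X\to X'$, $\sigma_2:Y\to Y'$ and $\sigma_2f=f'\sigma_1$. $\mathcal{P}(\Lambda)$ is the full subcategory of $\mathcal{H}(\Lambda)$ of objects $(P\xrightarrow{f}Q)$ with $P,Q$ projective. A right $\mathcal{P}(\Lambda)$-approximation of an object $\mathrm{X}$ is a morphism $\mathrm{P}\to\mathrm{X}$ with $\mathrm{P}\in\mathcal{P}(\Lambda)$ through which every morphism from an object of $\mathcal{P}(\Lambda)$ to $\mathrm{X}$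 factors. "Projective presentation" means an exact sequence $P_1\to P_0\to M\to 0$ with $P_0,P_1$ projective (not necessarily minimal). *)

theory Defs
  imports "HOL-Algebra.Module" "HOL-Algebra.Ideal"
begin

text \<open>
  HOL-Algebra only has modules over commutative rings, so right modules over an arbitrary ring
  are defined here on its module record. The scalar \<open>a \<odot>\<^bsub>M\<^esub> x\<close> stands for \<open>x \<cdot> a\<close>, hence the order
  of the factors in \<open>smult_assoc\<close>; the ring multiplication and unit fields of the record
  are not used. Maps are total functions that matter on carriers only, so equality of morphisms
  is always equality on the carrier.
\<close>

locale right_module = L?: ring L + M?: abelian_group M
  for L :: "'a ring" (structure) and M :: "('a, 'm) module" (structure) +
  assumes smult_closed: "\<lbrakk>a \<in> carrier L; x \<in> carrier M\<rbrakk> \<Longrightarrow> a \<odot>\<^bsub>M\<^esub> x \<in> carrier M"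
    and smult_l_distr: "\<lbrakk>a \<in> carrier L; b \<in> carrier L; x \<in> carrier M\<rbrakk>
      \<Longrightarrow> (a \<oplus>\<^bsub>L\<^esub> b) \<odot>\<^bsub>M\<^esub> x = a \<odot>\<^bsub>M\<^esub> x \<oplus>\<^bsub>M\<^esub> b \<odot>\<^bsub>M\<^esub> x"
    and smult_r_distr: "\<lbrakk>a \<in> carrier L; x \<in> carrier M; y \<in> carrier M\<rbrakk>
      \<Longrightarrow> a \<odot>\<^bsub>M\<^esub> (x \<oplus>\<^bsub>M\<^esub> y) = a \<odot>\<^bsub>M\<^esub> x \<oplus>\<^bsub>M\<^esub> a \<odot>\<^bsub>M\<^esub> y"
    and smult_assoc: "\<lbrakk>a \<in> carrier L; b \<in> carrier L; x \<in> carrier M\<rbrakk>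
      \<Longrightarrow> (a \<otimes>\<^bsub>L\<^esub> b) \<odot>\<^bsub>M\<^esub> x = b \<odot>\<^bsub>M\<^esub> (a \<odot>\<^bsub>M\<^esub> x)"
    and smult_one: "x \<in> carrier M \<Longrightarrow> \<one>\<^bsub>L\<^esub> \<odot>\<^bsub>M\<^esub> x = x"

definition artinian_cring :: "'r ring \<Rightarrow> bool" where
  "artinian_cring R \<longleftrightarrow> cring R \<and>
     (\<forall>I :: nat \<Rightarrow> 'r set. (\<forall>n. ideal (I n) R) \<and> (\<forall>n. I (Suc n) \<subseteq> I n) \<longrightarrow>
        (\<exists>N. \<forall>n\<ge>N. I n = I N))"

text \<open>The \<open>R\<close>-algebra structure on \<open>L\<close> is given by a ring homomorphism into the centre.\<close>

definition artin_algebra :: "'r ring \<Rightarrow> 'a ring \<Rightarrow> ('r \<Rightarrow> 'a) \<Rightarrow> bool" where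
  "artin_algebra R L \<phi> \<longleftrightarrow> artinian_cring R \<and> ring L \<and> \<phi> \<in> ring_hom R L \<and>
     (\<forall>r\<in>carrier R. \<forall>x\<in>carrier L. \<phi> r \<otimes>\<^bsub>L\<^esub> x = x \<otimes>\<^bsub>L\<^esub> \<phi> r) \<and>
     (\<exists>S\<subseteq>carrier L. finite S \<and>
        (\<forall>x\<in>carrier L. \<exists>c\<in>S \<rightarrow> carrier R. x = (\<Oplus>\<^bsub>L\<^esub>s\<in>S. \<phi> (c s) \<otimes>\<^bsub>L\<^esub> s)))"

definition fg_module :: "'a ring \<Rightarrow> ('a, 'm) module \<Rightarrow> bool" where
  "fg_module L M \<longleftrightarrow> right_module L M \<and>
     (\<exists>S\<subseteq>carrier M. finite S \<and>
        (\<forall>x\<in>carrier M. \<exists>c\<in>S \<rightarrow> carrier L. x = (\<Oplus>\<^bsub>M\<^esub>s\<in>S. c s \<odot>\<^bsub>M\<^esub> s)))"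

definition mod_hom :: "'a ring \<Rightarrow> ('a, 'm) module \<Rightarrow> ('a, 'n) module \<Rightarrow> ('m \<Rightarrow> 'n) set" where
  "mod_hom L M N = {h \<in> hom (add_monoid M) (add_monoid N).
     \<forall>a\<in>carrier L. \<forall>x\<in>carrier M. h (a \<odot>\<^bsub>M\<^esub> x) = a \<odot>\<^bsub>N\<^esub> h x}"

definition mod_epi :: "'a ring \<Rightarrow> ('a, 'm) module \<Rightarrow> ('a, 'n) module \<Rightarrow> ('m \<Rightarrow> 'n) set" where
  "mod_epi L M N = {h \<in> mod_hom L M N. h ` carrier M = carrier N}"

text \<open>
  A definition cannot quantify over all carrier types. Universal properties of objects of the
  category of finitely generated modules are therefore tested on the modules with carrier in the
  following type, which loses nothing: by \<open>fg_module_iso_universe\<close> below, every finitely generated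
  \<open>L\<close>-module, over any type, is isomorphic to one of these.
\<close>

type_synonym 'a univ = "(nat \<Rightarrow> 'a) set"

definition projective :: "'a ring \<Rightarrow> ('a, 'p) module \<Rightarrow> bool" where
  "projective L P \<longleftrightarrow> fg_module L P \<and>
     (\<forall>(X :: ('a, 'a univ) module) (Y :: ('a, 'a univ) module).
        fg_module L X \<and> fg_module L Y \<longrightarrow>
        (\<forall>p\<in>mod_epi L X Y. \<forall>q\<in>mod_hom L P Y.
           \<exists>r\<in>mod_hom L P X. \<forall>x\<in>carrier P. p (r x) = q x))"

definition projective_presentation :: "'a ring \<Rightarrow> ('a, 'p) module \<Rightarrow> ('a, 'q) module \<Rightarrow>
    ('a, 'm) module \<Rightarrow> ('p \<Rightarrow> 'q) \<Rightarrow> ('q \<Rightarrow> 'm) \<Rightarrow> bool" where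
  "projective_presentation L P1 P0 M f \<sigma> \<longleftrightarrow> projective L P1 \<and> projective L P0 \<and>
     fg_module L M \<and> f \<in> mod_hom L P1 P0 \<and> \<sigma> \<in> mod_epi L P0 M \<and>
     f ` carrier P1 = a_kernel P0 M \<sigma>"

text \<open>\<open>U\<close> with \<open>h : U \<rightarrow> N\<close> and \<open>d : U \<rightarrow> P\<close> is a pullback of \<open>g : N \<rightarrow> M\<close> along \<open>\<sigma> : P \<rightarrow> M\<close>.\<close>

definition is_pullback :: "'a ring \<Rightarrow> ('a, 'n) module \<Rightarrow> ('a, 'p) module \<Rightarrow> ('a, 'm) module \<Rightarrow>
    ('n \<Rightarrow> 'm) \<Rightarrow> ('p \<Rightarrow> 'm) \<Rightarrow> ('a, 'u) module \<Rightarrow> ('u \<Rightarrow> 'n) \<Rightarrow> ('u \<Rightarrow> 'p) \<Rightarrow> bool" where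
  "is_pullback L N P M g \<sigma> U h d \<longleftrightarrow> fg_module L U \<and> h \<in> mod_hom L U N \<and> d \<in> mod_hom L U P \<and>
     (\<forall>u\<in>carrier U. \<sigma> (d u) = g (h u)) \<and>
     (\<forall>(T :: ('a, 'a univ) module) a b.
        fg_module L T \<and> a \<in> mod_hom L T N \<and> b \<in> mod_hom L T P \<and>
        (\<forall>t\<in>carrier T. \<sigma> (b t) = g (a t)) \<longrightarrow>
        (\<exists>v\<in>mod_hom L T U. (\<forall>t\<in>carrier T. h (v t) = a t \<and> d (v t) = b t) \<and>
           (\<forall>w\<in>mod_hom L T U. (\<forall>t\<in>carrier T. h (w t) = a t \<and> d (w t) = b t) \<longrightarrow>
              (\<forall>t\<in>carrier T. w t = v t))))"

definition dsum :: "('a, 'm) module \<Rightarrow> ('a, 'n) module \<Rightarrow> ('a, 'm \<times> 'n) module" where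
  "dsum M N = \<lparr>carrier = carrier M \<times> carrier N, mult = undefined, one = undefined,
     zero = (\<zero>\<^bsub>M\<^esub>, \<zero>\<^bsub>N\<^esub>),
     add = (\<lambda>(x, y) (x', y'). (x \<oplus>\<^bsub>M\<^esub> x', y \<oplus>\<^bsub>N\<^esub> y')),
     smult = (\<lambda>a (x, y). (a \<odot>\<^bsub>M\<^esub> x, a \<odot>\<^bsub>N\<^esub> y))\<rparr>"

text \<open>The row matrix \<open>[u v]\<close>, a map from a direct sum to \<open>K\<close>.\<close>

definition row_map :: "('a, 'k) module \<Rightarrow> ('m \<Rightarrow> 'k) \<Rightarrow> ('n \<Rightarrow> 'k) \<Rightarrow> 'm \<times> 'n \<Rightarrow> 'k" where
  "row_map K u v = (\<lambda>(x, y). u x \<oplus>\<^bsub>K\<^esub> v y)"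

record ('a, 'x, 'y) mor =
  src :: "('a, 'x) module"
  tgt :: "('a, 'y) module"
  arr :: "'x \<Rightarrow> 'y"

definition H_obj :: "'a ring \<Rightarrow> ('a, 'x, 'y) mor \<Rightarrow> bool" where
  "H_obj L X \<longleftrightarrow> fg_module L (src X) \<and> fg_module L (tgt X) \<and> arr X \<in> mod_hom L (src X) (tgt X)"

definition H_hom :: "'a ring \<Rightarrow> ('a, 'x, 'y) mor \<Rightarrow> ('a, 'x', 'y') mor \<Rightarrow>
    (('x \<Rightarrow> 'x') \<times> ('y \<Rightarrow> 'y')) set" where
  "H_hom L X X' = {(s1, s2). s1 \<in> mod_hom L (src X) (src X') \<and> s2 \<in> mod_hom L (tgt X) (tgt X') \<and>
     (\<forall>x\<in>carrier (src X). s2 (arr X x) = arr X' (s1 x))}"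

definition P_obj :: "'a ring \<Rightarrow> ('a, 'x, 'y) mor \<Rightarrow> bool" where
  "P_obj L X \<longleftrightarrow> H_obj L X \<and> projective L (src X) \<and> projective L (tgt X)"

text \<open>
  The two type arguments are the carrier types of the test objects; a statement that leaves them
  as type variables covers test objects over all types.
\<close>

definition right_P_approximation :: "'x itself \<Rightarrow> 'y itself \<Rightarrow> 'a ring \<Rightarrow>
    ('a, 'p, 'q) mor \<Rightarrow> ('a, 'n, 'm) mor \<Rightarrow> ('p \<Rightarrow> 'n) \<times> ('q \<Rightarrow> 'm) \<Rightarrow> bool" where
  "right_P_approximation TYPE('x) TYPE('y) L P X \<pi> \<longleftrightarrow>
     H_obj L X \<and> P_obj L P \<and> \<pi> \<in> H_hom L P X \<and>
     (\<forall>T :: ('a, 'x, 'y) mor. P_obj L T \<longrightarrow>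
        (\<forall>\<psi>\<in>H_hom L T X. \<exists>\<theta>\<in>H_hom L T P.
           (\<forall>x\<in>carrier (src T). fst \<pi> (fst \<theta> x) = fst \<psi> x) \<and>
           (\<forall>y\<in>carrier (tgt T). snd \<pi> (snd \<theta> y) = snd \<psi> y)))"

lemma fg_module_iso_universe:
  fixes L :: "'a ring" and M :: "('a, 'm) module"
  assumes fg: "fg_module L M"
  shows "\<exists>(M' :: ('a, 'a univ) module) i. fg_module L M' \<and> i \<in> mod_hom L M M' \<and>
           bij_betw i (carrier M) (carrier M')"
proof -
  interpret M: right_module L M using fg by (simp add: fg_module_def)
  obtain S where S: "S \<subseteq> carrier M" "finite S"
    and gen: "\<And>x. x \<in> carrier M \<Longrightarrow> \<exists>c\<in>S \<rightarrow> carrier L. x = (\<Oplus>\<^bsub>M\<^esub>s\<in>S. c s \<odot>\<^bsub>M\<^esub> s)"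
    using fg by (auto simp: fg_module_def)
  obtain e :: "'m \<Rightarrow> nat" where e: "inj_on e S"
    using S(2) finite_imp_inj_to_nat_seg by metis
  define i where "i x = {c :: nat \<Rightarrow> 'a. x = (\<Oplus>\<^bsub>M\<^esub>s\<in>S. c (e s) \<odot>\<^bsub>M\<^esub> s)}" for x
  have ne: "i x \<noteq> {}" if x: "x \<in> carrier M" for x
  proof -
    obtain c where c: "c \<in> S \<rightarrow> carrier L" "x = (\<Oplus>\<^bsub>M\<^esub>s\<in>S. c s \<odot>\<^bsub>M\<^esub> s)" using gen[OF x] by auto
    have "(\<Oplus>\<^bsub>M\<^esub>s\<in>S. (c \<circ> inv_into S e) (e s) \<odot>\<^bsub>M\<^esub> s) = (\<Oplus>\<^bsub>M\<^esub>s\<in>S. c s \<odot>\<^bsub>M\<^esub> s)"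
      using c S e by (intro M.M.finsum_cong') (auto intro!: M.smult_closed)
    then have "(c \<circ> inv_into S e) \<in> i x" using c by (simp add: i_def)
    then show ?thesis by blast
  qed
  have inj: "inj_on i (carrier M)"
  proof (rule inj_onI)
    fix x y assume xy: "x \<in> carrier M" "y \<in> carrier M" "i x = i y"
    obtain c where "c \<in> i x" using ne[OF xy(1)] by blast
    moreover from this have "c \<in> i y" using xy by simp
    ultimately show "x = y" by (simp add: i_def)
  qed
  define j where "j = inv_into (carrier M) i"
  have ji [simp]: "j (i x) = x" if "x \<in> carrier M" for x
    using that inj by (simp add: j_def)
  define M' :: "('a, 'a univ) module" where
    "M' = \<lparr>carrier = i ` carrier M, mult = undefined, one = undefined, zero = i \<zero>\<^bsub>M\<^esub>,
       add = (\<lambda>u v. i (j u \<oplus>\<^bsub>M\<^esub> j v)), smult = (\<lambda>a u. i (a \<odot>\<^bsub>M\<^esub> j u))\<rparr>"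
  have sel [simp]: "carrier M' = i ` carrier M" "zero M' = i \<zero>\<^bsub>M\<^esub>"
    "add M' u v = i (j u \<oplus>\<^bsub>M\<^esub> j v)" "smult M' a u = i (a \<odot>\<^bsub>M\<^esub> j u)" for u v a
    by (simp_all add: M'_def)
  note M.smult_closed [simp]
  have ab: "abelian_group M'"
  proof (rule abelian_groupI)
    fix u assume "u \<in> carrier M'"
    then obtain x where x: "x \<in> carrier M" "u = i x" by auto
    show "\<exists>v\<in>carrier M'. v \<oplus>\<^bsub>M'\<^esub> u = \<zero>\<^bsub>M'\<^esub>"
      using x by (intro bexI[of _ "i (\<ominus>\<^bsub>M\<^esub> x)"]) (auto simp: M.M.l_neg)
  qed (auto simp: M.M.a_ac)
  interpret M': abelian_group M' by (rule ab)
  have rm: "right_module L M'"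
    by unfold_locales
      (auto simp: M.smult_l_distr M.smult_r_distr M.smult_assoc M.smult_one)
  have hom: "i \<in> mod_hom L M M'"
    by (auto simp: mod_hom_def hom_def)
  have fs: "i (\<Oplus>\<^bsub>M\<^esub>s\<in>A. f s) = (\<Oplus>\<^bsub>M'\<^esub>s\<in>A. i (f s))" if "finite A" "f \<in> A \<rightarrow> carrier M"
    for A and f :: "'m \<Rightarrow> 'm"
    using that
  proof (induction A rule: finite_induct)
    case (insert a A)
    have "(\<Oplus>\<^bsub>M'\<^esub>s\<in>insert a A. i (f s)) = i (f a) \<oplus>\<^bsub>M'\<^esub> (\<Oplus>\<^bsub>M'\<^esub>s\<in>A. i (f s))"
      using insert by (intro M'.finsum_insert) auto
    also have "(\<Oplus>\<^bsub>M'\<^esub>s\<in>A. i (f s)) = i (\<Oplus>\<^bsub>M\<^esub>s\<in>A. f s)"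
      using insert by simp
    finally show ?case using insert.prems insert.hyps by (auto simp: Pi_iff)
  qed simp
  have "\<exists>c\<in>i ` S \<rightarrow> carrier L. u = (\<Oplus>\<^bsub>M'\<^esub>s\<in>i ` S. c s \<odot>\<^bsub>M'\<^esub> s)" if u: "u \<in> carrier M'" for u
  proof -
    obtain x where x: "x \<in> carrier M" "u = i x" using u by auto
    obtain c where c: "c \<in> S \<rightarrow> carrier L" "x = (\<Oplus>\<^bsub>M\<^esub>s\<in>S. c s \<odot>\<^bsub>M\<^esub> s)" using gen[OF x(1)] by auto
    have cS: "c s \<odot>\<^bsub>M\<^esub> s \<in> carrier M" if "s \<in> S" for s using that S(1) by (intro M.smult_closed Pi_mem[OF c(1)]) auto
    have "(\<Oplus>\<^bsub>M'\<^esub>s\<in>i ` S. (c \<circ> j) s \<odot>\<^bsub>M'\<^esub> s) = (\<Oplus>\<^bsub>M'\<^esub>s\<in>S. (c \<circ> j) (i s) \<odot>\<^bsub>M'\<^esub> i s)"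
      using cS S inj_on_subset[OF inj S(1)] by (intro M'.add.finprod_reindex) (auto simp: subset_iff)
    also have "\<dots> = (\<Oplus>\<^bsub>M'\<^esub>s\<in>S. i (c s \<odot>\<^bsub>M\<^esub> s))"
      using cS S by (intro M'.finsum_cong') (auto simp: subset_iff)
    also have "\<dots> = u" using fs[of S "\<lambda>s. c s \<odot>\<^bsub>M\<^esub> s"] cS S c x by auto
    finally show ?thesis using c S by (intro bexI[of _ "c \<circ> j"]) (auto simp: subset_iff)
  qed
  then have "fg_module L M'"
    unfolding fg_module_def using rm S by (auto intro!: exI[of _ "i ` S"])
  then show ?thesis using hom inj by (intro exI[of _ M'] exI[of _ i]) (simp add: bij_betw_def)
qed

end

theory Submission
  imports Defs
begin

text \<open>
  Given a test object \<open>t : A \<rightarrow> B\<close> with \<open>A\<close>, \<open>B\<close> projective and a morphism \<open>(s\<^sub>1, s\<^sub>2)\<close> to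
  \<open>g : N \<rightarrow> M\<close>, lift \<open>s\<^sub>2\<close> along \<open>\<sigma>\<close> to \<open>w\<close> and \<open>s\<^sub>1\<close> along \<open>e\<close> to \<open>r\<close>. Since \<open>h e' = e\<close> and
  \<open>\<sigma> d = g h\<close>, the map \<open>w t - d e' r\<close> is killed by \<open>\<sigma>\<close>, so it lands in the image of \<open>f\<close> and lifts
  along \<open>f\<close> to some \<open>k : A \<rightarrow> P\<^sub>1\<close>; the factorisation is \<open>((k, r), w)\<close>. That the kernel of \<open>\<sigma>\<close> is
  finitely generated comes from its being the image of \<open>P\<^sub>1\<close>.
\<close>

section \<open>Modules and homomorphisms\<close>

lemma mod_homI:
  assumes "\<And>x. x \<in> carrier M \<Longrightarrow> h x \<in> carrier N"
    and "\<And>x y. \<lbrakk>x \<in> carrier M; y \<in> carrier M\<rbrakk> \<Longrightarrow> h (x \<oplus>\<^bsub>M\<^esub> y) = h x \<oplus>\<^bsub>N\<^esub> h y"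
    and "\<And>a x. \<lbrakk>a \<in> carrier L; x \<in> carrier M\<rbrakk> \<Longrightarrow> h (a \<odot>\<^bsub>M\<^esub> x) = a \<odot>\<^bsub>N\<^esub> h x"
  shows "h \<in> mod_hom L M N"
  using assms by (auto simp: mod_hom_def hom_def)

lemma mod_hom_closed: "\<lbrakk>h \<in> mod_hom L M N; x \<in> carrier M\<rbrakk> \<Longrightarrow> h x \<in> carrier N"
  by (auto simp: mod_hom_def hom_def)

lemma mod_hom_add: "\<lbrakk>h \<in> mod_hom L M N; x \<in> carrier M; y \<in> carrier M\<rbrakk>
    \<Longrightarrow> h (x \<oplus>\<^bsub>M\<^esub> y) = h x \<oplus>\<^bsub>N\<^esub> h y"
  by (auto simp: mod_hom_def hom_def)

lemma mod_hom_smult: "\<lbrakk>h \<in> mod_hom L M N; a \<in> carrier L; x \<in> carrier M\<rbrakk>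
    \<Longrightarrow> h (a \<odot>\<^bsub>M\<^esub> x) = a \<odot>\<^bsub>N\<^esub> h x"
  by (auto simp: mod_hom_def)

lemmas mod_hom_simps = mod_hom_closed mod_hom_add mod_hom_smult

lemma mod_hom_zero:
  assumes "right_module L M" "right_module L N" "h \<in> mod_hom L M N"
  shows "h \<zero>\<^bsub>M\<^esub> = \<zero>\<^bsub>N\<^esub>"
proof -
  interpret M: right_module L M by fact
  interpret N: right_module L N by fact
  have "h \<zero>\<^bsub>M\<^esub> \<oplus>\<^bsub>N\<^esub> h \<zero>\<^bsub>M\<^esub> = h \<zero>\<^bsub>M\<^esub>"
    using mod_hom_add[OF assms(3), of "\<zero>\<^bsub>M\<^esub>" "\<zero>\<^bsub>M\<^esub>"] by simp
  then show ?thesis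
    using mod_hom_closed[OF assms(3), of "\<zero>\<^bsub>M\<^esub>"] by (metis M.M.zero_closed N.M.add.l_cancel_one)
qed

lemma mod_hom_comp:
  "\<lbrakk>u \<in> mod_hom L A B; v \<in> mod_hom L B C\<rbrakk> \<Longrightarrow> v \<circ> u \<in> mod_hom L A C"
  by (intro mod_homI) (auto simp: mod_hom_simps)

text \<open>Every element of \<open>N\<close> is some \<open>u x\<close>, so both operations on
  \<open>N\<close> can be computed in \<open>M\<close>; this is why only \<open>M\<close> has to be
  a module. The inverse isomorphism brings lifts back from the copies over \<open>'a univ\<close> in
  \<open>projective_lift\<close>.\<close>

lemma mod_hom_inv_into:
  assumes M: "right_module L M" and u: "u \<in> mod_hom L M N" "bij_betw u (carrier M) (carrier N)"
  shows "inv_into (carrier M) u \<in> mod_hom L N M"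
proof -
  interpret M: right_module L M by (rule M)
  have inj: "inj_on u (carrier M)" and N: "carrier N = u ` carrier M"
    using u(2) by (auto simp: bij_betw_def)
  show ?thesis
  proof (rule mod_homI)
    fix x y assume "x \<in> carrier N" "y \<in> carrier N"
    then obtain x' y' where "x' \<in> carrier M" "x = u x'" "y' \<in> carrier M" "y = u y'"
      using N by auto
    then show "inv_into (carrier M) u (x \<oplus>\<^bsub>N\<^esub> y) =
        inv_into (carrier M) u x \<oplus>\<^bsub>M\<^esub> inv_into (carrier M) u y"
      using inj by (simp flip: mod_hom_add[OF u(1)])
  next
    fix a x assume "a \<in> carrier L" "x \<in> carrier N"
    moreover from this obtain x' where "x' \<in> carrier M" "x = u x'" using N by auto
    ultimately show "inv_into (carrier M) u (a \<odot>\<^bsub>N\<^esub> x) = a \<odot>\<^bsub>M\<^esub> inv_into (carrier M) u x"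
      using inj by (simp add: M.smult_closed flip: mod_hom_smult[OF u(1)])
  qed (simp add: N inv_into_into)
qed

context right_module
begin

lemma smult_zero_left: "x \<in> carrier M \<Longrightarrow> \<zero>\<^bsub>L\<^esub> \<odot>\<^bsub>M\<^esub> x = \<zero>\<^bsub>M\<^esub>"
  using smult_l_distr[of "\<zero>\<^bsub>L\<^esub>" "\<zero>\<^bsub>L\<^esub>" x] smult_closed[of "\<zero>\<^bsub>L\<^esub>" x]
  by (metis L.l_zero L.zero_closed M.add.l_cancel_one)

lemma smult_zero_right: "a \<in> carrier L \<Longrightarrow> a \<odot>\<^bsub>M\<^esub> \<zero>\<^bsub>M\<^esub> = \<zero>\<^bsub>M\<^esub>"
  using smult_r_distr[of a "\<zero>\<^bsub>M\<^esub>" "\<zero>\<^bsub>M\<^esub>"] smult_closed[of a "\<zero>\<^bsub>M\<^esub>"]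
  by (metis M.l_zero M.zero_closed M.add.l_cancel_one)

lemma smult_minus_right:
  assumes "a \<in> carrier L" "x \<in> carrier M"
  shows "a \<odot>\<^bsub>M\<^esub> (\<ominus>\<^bsub>M\<^esub> x) = \<ominus>\<^bsub>M\<^esub> (a \<odot>\<^bsub>M\<^esub> x)"
proof -
  have "a \<odot>\<^bsub>M\<^esub> (\<ominus>\<^bsub>M\<^esub> x) \<oplus>\<^bsub>M\<^esub> a \<odot>\<^bsub>M\<^esub> x = \<zero>\<^bsub>M\<^esub>"
    using assms by (simp add: M.l_neg smult_zero_right flip: smult_r_distr)
  then show ?thesis using assms by (intro M.minus_equality[symmetric]) (auto simp: smult_closed)
qed

lemma smult_minus_one:
  assumes "x \<in> carrier M"
  shows "(\<ominus>\<^bsub>L\<^esub> \<one>\<^bsub>L\<^esub>) \<odot>\<^bsub>M\<^esub> x = \<ominus>\<^bsub>M\<^esub> x"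
proof -
  have "(\<ominus>\<^bsub>L\<^esub> \<one>\<^bsub>L\<^esub>) \<odot>\<^bsub>M\<^esub> x \<oplus>\<^bsub>M\<^esub> x = (\<ominus>\<^bsub>L\<^esub> \<one>\<^bsub>L\<^esub> \<oplus>\<^bsub>L\<^esub> \<one>\<^bsub>L\<^esub>) \<odot>\<^bsub>M\<^esub> x"
    using assms by (simp add: smult_l_distr smult_one)
  also have "\<dots> = \<zero>\<^bsub>M\<^esub>" using assms by (simp add: L.l_neg smult_zero_left)
  finally show ?thesis using assms by (intro M.minus_equality[symmetric]) (auto simp: smult_closed)
qed

text \<open>Supplies the homomorphism \<open>w t - d e' r\<close> of the final argument. Additivity
  is a regrouping in the abelian group \<open>M\<close>; for scalars, the action must commute with
  negation.\<close>

lemma mod_hom_diff: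
  assumes u: "u \<in> mod_hom L A M" and v: "v \<in> mod_hom L A M"
  shows "(\<lambda>x. u x \<ominus>\<^bsub>M\<^esub> v x) \<in> mod_hom L A M"
  by (rule mod_homI)
    (auto simp: mod_hom_simps[OF u] mod_hom_simps[OF v] M.minus_eq M.minus_add M.a_ac
      smult_r_distr smult_minus_right)

end

section \<open>Submodules and finite generation\<close>

text \<open>Closure under negation is a consequence of closure under scalars: by
  \<open>smult_minus_one\<close> the negative of \<open>x\<close> is \<open>x\<close> acted on by
  the negative of the unit of \<open>L\<close>.\<close>

definition right_submodule :: "'a ring \<Rightarrow> ('a, 'm) module \<Rightarrow> 'm set \<Rightarrow> bool" where
  "right_submodule L M K \<longleftrightarrow> K \<subseteq> carrier M \<and> \<zero>\<^bsub>M\<^esub> \<in> K \<and>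
     (\<forall>x\<in>K. \<forall>y\<in>K. x \<oplus>\<^bsub>M\<^esub> y \<in> K) \<and> (\<forall>a\<in>carrier L. \<forall>x\<in>K. a \<odot>\<^bsub>M\<^esub> x \<in> K)"

lemma right_submodule_image:
  assumes "right_module L M" "right_module L N" "u \<in> mod_hom L M N"
  shows "right_submodule L N (u ` carrier M)"
proof -
  interpret M: right_module L M by fact
  note u = mod_hom_simps[OF assms(3)]
  show ?thesis
    unfolding right_submodule_def
    using mod_hom_zero[OF assms]
    by (auto simp: u M.smult_closed simp flip: u(2,3) intro!: imageI)
      (metis M.M.zero_closed imageI)
qed

text \<open>\<open>N'\<close> is \<open>N\<close> up to its carrier, so that \<open>K\<close> may live inside the image of \<open>u\<close>.\<close>

lemma right_submodule_vimage:
  assumes M: "right_module L M" and N: "right_module L N" and u: "u \<in> mod_hom L M N"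
    and K: "right_submodule L N' K"
    and eq: "zero N' = zero N" "add N' = add N" "smult N' = smult N"
  shows "right_submodule L M {x \<in> carrier M. u x \<in> K}"
proof -
  interpret M: right_module L M by (rule M)
  show ?thesis
    using K mod_hom_zero[OF M N u] unfolding right_submodule_def
    by (auto simp: mod_hom_simps[OF u] M.smult_closed eq)
qed

lemma right_module_submodule:
  assumes "right_module L M" "right_submodule L M K"
  shows "right_module L (M\<lparr>carrier := K\<rparr>)"
proof -
  interpret M: right_module L M by fact
  have KM: "x \<in> K \<Longrightarrow> x \<in> carrier M" for x using assms(2) by (auto simp: right_submodule_def)
  have K: "\<zero>\<^bsub>M\<^esub> \<in> K" "x \<in> K \<Longrightarrow> y \<in> K \<Longrightarrow> x \<oplus>\<^bsub>M\<^esub> y \<in> K"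
    "a \<in> carrier L \<Longrightarrow> x \<in> K \<Longrightarrow> a \<odot>\<^bsub>M\<^esub> x \<in> K" for a x y
    using assms(2) by (auto simp: right_submodule_def)
  have "\<ominus>\<^bsub>M\<^esub> x \<in> K" if "x \<in> K" for x
    using K(3)[of "\<ominus>\<^bsub>L\<^esub> \<one>\<^bsub>L\<^esub>" x] that KM by (simp add: M.smult_minus_one)
  then have "\<exists>y\<in>K. y \<oplus>\<^bsub>M\<^esub> x = \<zero>\<^bsub>M\<^esub>" if "x \<in> K" for x
    using that KM M.M.l_neg by blast
  then interpret K: abelian_group "M\<lparr>carrier := K\<rparr>"
    by (intro abelian_groupI) (auto simp: K KM M.M.a_ac)
  show ?thesis
    by unfold_locales
      (auto simp: K KM M.smult_l_distr M.smult_r_distr M.smult_assoc M.smult_one)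
qed

lemma (in right_module) right_submodule_finsum:
  assumes "right_submodule L M K" "finite A" "\<And>s. s \<in> A \<Longrightarrow> v s \<in> K"
  shows "(\<Oplus>\<^bsub>M\<^esub>s\<in>A. v s) \<in> K"
  using assms(2,3)
proof (induction A rule: finite_induct)
  case empty
  then show ?case using assms(1) by (simp add: right_submodule_def)
next
  case (insert a A)
  then have "(\<Oplus>\<^bsub>M\<^esub>s\<in>insert a A. v s) = v a \<oplus>\<^bsub>M\<^esub> (\<Oplus>\<^bsub>M\<^esub>s\<in>A. v s)"
    using assms(1) by (intro M.finsum_insert) (auto simp: right_submodule_def)
  then show ?case using insert assms(1) by (auto simp: right_submodule_def)
qed

lemma (in right_module) smult_finsum:
  assumes "finite A" "a \<in> carrier L" "v \<in> A \<rightarrow> carrier M"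
  shows "a \<odot>\<^bsub>M\<^esub> (\<Oplus>\<^bsub>M\<^esub>s\<in>A. v s) = (\<Oplus>\<^bsub>M\<^esub>s\<in>A. a \<odot>\<^bsub>M\<^esub> v s)"
  using assms(1,3)
proof (induction A rule: finite_induct)
  case empty
  then show ?case using assms(2) by (simp add: smult_zero_right)
next
  case (insert b A)
  have "(\<Oplus>\<^bsub>M\<^esub>s\<in>insert b A. a \<odot>\<^bsub>M\<^esub> v s) = a \<odot>\<^bsub>M\<^esub> v b \<oplus>\<^bsub>M\<^esub> (\<Oplus>\<^bsub>M\<^esub>s\<in>A. a \<odot>\<^bsub>M\<^esub> v s)"
    using insert assms(2) by (intro M.finsum_insert) (auto intro!: smult_closed)
  moreover have "(\<Oplus>\<^bsub>M\<^esub>s\<in>insert b A. v s) = v b \<oplus>\<^bsub>M\<^esub> (\<Oplus>\<^bsub>M\<^esub>s\<in>A. v s)"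
    using insert by (intro M.finsum_insert) auto
  ultimately show ?case
    using insert assms(2) by (simp add: smult_r_distr Pi_iff)
qed

text \<open>Combinations are added and scaled coefficientwise. With
  \<open>subset_combinations\<close> this makes the explicit span of \<open>S\<close> a submodule
  containing \<open>S\<close>, which is what \<open>fg_module_iff\<close> needs.\<close>

lemma (in right_module) right_submodule_combinations:
  assumes "S \<subseteq> carrier M" "finite S"
  shows "right_submodule L M {\<Oplus>\<^bsub>M\<^esub>s\<in>S. c s \<odot>\<^bsub>M\<^esub> s |c. c \<in> S \<rightarrow> carrier L}"
    (is "right_submodule L M ?C")
proof -
  have cl: "c s \<odot>\<^bsub>M\<^esub> s \<in> carrier M" if "c \<in> S \<rightarrow> carrier L" "s \<in> S" for c s
    using that assms(1) by (intro smult_closed) auto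
  then have cl': "(\<lambda>s. c s \<odot>\<^bsub>M\<^esub> s) \<in> S \<rightarrow> carrier M" if "c \<in> S \<rightarrow> carrier L" for c
    using that by auto
  show ?thesis
    unfolding right_submodule_def
  proof (intro conjI ballI)
    show "?C \<subseteq> carrier M" using cl' by (auto intro!: M.finsum_closed)
    have "(\<Oplus>\<^bsub>M\<^esub>s\<in>S. \<zero>\<^bsub>L\<^esub> \<odot>\<^bsub>M\<^esub> s) = \<zero>\<^bsub>M\<^esub>"
      using assms(1) by (intro M.add.finprod_one_eqI) (auto simp: smult_zero_left)
    then show "\<zero>\<^bsub>M\<^esub> \<in> ?C" by (auto intro!: exI[of _ "\<lambda>_. \<zero>\<^bsub>L\<^esub>"])
  next
    fix x y assume "x \<in> ?C" "y \<in> ?C"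
    then obtain c b where cb: "c \<in> S \<rightarrow> carrier L" "b \<in> S \<rightarrow> carrier L"
      and xy: "x = (\<Oplus>\<^bsub>M\<^esub>s\<in>S. c s \<odot>\<^bsub>M\<^esub> s)" "y = (\<Oplus>\<^bsub>M\<^esub>s\<in>S. b s \<odot>\<^bsub>M\<^esub> s)" by auto
    have "x \<oplus>\<^bsub>M\<^esub> y = (\<Oplus>\<^bsub>M\<^esub>s\<in>S. c s \<odot>\<^bsub>M\<^esub> s \<oplus>\<^bsub>M\<^esub> b s \<odot>\<^bsub>M\<^esub> s)"
      using cb by (simp add: xy cl' M.finsum_addf)
    also have "\<dots> = (\<Oplus>\<^bsub>M\<^esub>s\<in>S. (c s \<oplus>\<^bsub>L\<^esub> b s) \<odot>\<^bsub>M\<^esub> s)"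
      using cb assms(1) cl by (intro M.finsum_cong') (auto simp: smult_l_distr Pi_iff subset_iff)
    finally show "x \<oplus>\<^bsub>M\<^esub> y \<in> ?C"
      using cb by (auto intro!: exI[of _ "\<lambda>s. c s \<oplus>\<^bsub>L\<^esub> b s"])
  next
    fix a x assume a: "a \<in> carrier L" and "x \<in> ?C"
    then obtain c where c: "c \<in> S \<rightarrow> carrier L" and x: "x = (\<Oplus>\<^bsub>M\<^esub>s\<in>S. c s \<odot>\<^bsub>M\<^esub> s)" by auto
    have "a \<odot>\<^bsub>M\<^esub> x = (\<Oplus>\<^bsub>M\<^esub>s\<in>S. a \<odot>\<^bsub>M\<^esub> (c s \<odot>\<^bsub>M\<^esub> s))"
      using c a assms(2) cl' by (simp add: x smult_finsum)
    \<comment> \<open>The action is on the right: acting with \<open>c s\<close> and then with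
      \<open>a\<close> is acting with the product of \<open>c s\<close> and \<open>a\<close> in that
      order.\<close>
    also have "\<dots> = (\<Oplus>\<^bsub>M\<^esub>s\<in>S. (c s \<otimes>\<^bsub>L\<^esub> a) \<odot>\<^bsub>M\<^esub> s)"
      using c a assms(1)
      by (intro M.finsum_cong') (auto simp: smult_assoc Pi_iff subset_iff intro!: smult_closed)
    finally show "a \<odot>\<^bsub>M\<^esub> x \<in> ?C"
      using c a by (auto intro!: exI[of _ "\<lambda>s. c s \<otimes>\<^bsub>L\<^esub> a"])
  qed
qed

lemma (in right_module) subset_combinations:
  assumes "S \<subseteq> carrier M" "finite S"
  shows "S \<subseteq> {\<Oplus>\<^bsub>M\<^esub>s\<in>S. c s \<odot>\<^bsub>M\<^esub> s |c. c \<in> S \<rightarrow> carrier L}"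
proof
  fix s assume s: "s \<in> S"
  \<comment> \<open>Kronecker delta coefficients: all terms but the one at \<open>s\<close>
    vanish.\<close>
  define c where "c t = (if s = t then \<one>\<^bsub>L\<^esub> else \<zero>\<^bsub>L\<^esub>)" for t
  have "(\<Oplus>\<^bsub>M\<^esub>t\<in>S. c t \<odot>\<^bsub>M\<^esub> t) = (\<Oplus>\<^bsub>M\<^esub>t\<in>S. if s = t then t else \<zero>\<^bsub>M\<^esub>)"
    using assms(1)
    by (intro M.finsum_cong') (auto simp: c_def smult_one smult_zero_left subset_iff)
  also have "\<dots> = s" using s assms by (intro M.add.finprod_singleton) auto
  finally show "s \<in> {\<Oplus>\<^bsub>M\<^esub>s\<in>S. c s \<odot>\<^bsub>M\<^esub> s |c. c \<in> S \<rightarrow> carrier L}"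
    by (auto simp: c_def intro!: exI[of _ c])
qed

text \<open>Replaces explicit combinations by a test on submodules. Finite generation can then be
  transferred along a homomorphism by taking the preimage of a submodule, with no calculation on
  sums.\<close>

lemma fg_module_iff:
  "fg_module L M \<longleftrightarrow> right_module L M \<and>
     (\<exists>S\<subseteq>carrier M. finite S \<and> (\<forall>K. right_submodule L M K \<and> S \<subseteq> K \<longrightarrow> K = carrier M))"
proof (intro iffI conjI)
  assume fg: "fg_module L M"
  then show "right_module L M" by (simp add: fg_module_def)
  then interpret right_module L M .
  obtain S where S: "S \<subseteq> carrier M" "finite S"
    and gen: "\<And>x. x \<in> carrier M \<Longrightarrow> \<exists>c\<in>S \<rightarrow> carrier L. x = (\<Oplus>\<^bsub>M\<^esub>s\<in>S. c s \<odot>\<^bsub>M\<^esub> s)"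
    using fg by (auto simp: fg_module_def)
  have "K = carrier M" if K: "right_submodule L M K" "S \<subseteq> K" for K
  proof
    show "K \<subseteq> carrier M" using K by (simp add: right_submodule_def)
    show "carrier M \<subseteq> K"
    proof
      fix x assume "x \<in> carrier M"
      then obtain c where "c \<in> S \<rightarrow> carrier L" and x: "x = (\<Oplus>\<^bsub>M\<^esub>s\<in>S. c s \<odot>\<^bsub>M\<^esub> s)"
        using gen by blast
      then have "c s \<odot>\<^bsub>M\<^esub> s \<in> K" if "s \<in> S" for s
        using that K by (auto simp: right_submodule_def Pi_iff subset_iff)
      then show "x \<in> K" unfolding x by (intro right_submodule_finsum K(1) S(2))
    qed
  qed
  then show "\<exists>S\<subseteq>carrier M. finite S \<and> (\<forall>K. right_submodule L M K \<and> S \<subseteq> K \<longrightarrow> K = carrier M)"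
    using S by blast
next
  assume *: "right_module L M \<and>
     (\<exists>S\<subseteq>carrier M. finite S \<and> (\<forall>K. right_submodule L M K \<and> S \<subseteq> K \<longrightarrow> K = carrier M))"
  then interpret right_module L M by simp
  obtain S where S: "S \<subseteq> carrier M" "finite S"
    and K: "\<And>K. right_submodule L M K \<Longrightarrow> S \<subseteq> K \<Longrightarrow> K = carrier M" using * by blast
  \<comment> \<open>The test is applied to one submodule, the span of \<open>S\<close>; that it
    exhausts \<open>M\<close> is the original definition.\<close>
  have "{\<Oplus>\<^bsub>M\<^esub>s\<in>S. c s \<odot>\<^bsub>M\<^esub> s |c. c \<in> S \<rightarrow> carrier L} = carrier M"
    by (intro K right_submodule_combinations subset_combinations S)
  then have "\<forall>x\<in>carrier M. \<exists>c\<in>S \<rightarrow> carrier L. x = (\<Oplus>\<^bsub>M\<^esub>s\<in>S. c s \<odot>\<^bsub>M\<^esub> s)" by blast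
  then show "fg_module L M"
    unfolding fg_module_def using * S by blast
qed

lemma fg_module_right_module: "fg_module L M \<Longrightarrow> right_module L M"
  by (simp add: fg_module_def)

text \<open>The images of the generators of \<open>X\<close> generate: if a submodule contains them,
  its preimage in \<open>X\<close> is a submodule containing \<open>S\<close>, hence all of
  \<open>X\<close>.\<close>

lemma fg_module_image:
  assumes X: "fg_module L X" and Y: "right_module L Y" and u: "u \<in> mod_hom L X Y"
  shows "fg_module L (Y\<lparr>carrier := u ` carrier X\<rparr>)"
proof -
  note rX = fg_module_right_module[OF X]
  obtain S where S: "S \<subseteq> carrier X" "finite S"
    and gen: "\<And>K. right_submodule L X K \<Longrightarrow> S \<subseteq> K \<Longrightarrow> K = carrier X"
    using X by (auto simp: fg_module_iff)
  have "K = u ` carrier X"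
    if K: "right_submodule L (Y\<lparr>carrier := u ` carrier X\<rparr>) K" "u ` S \<subseteq> K" for K
  proof
    show "K \<subseteq> u ` carrier X" using K by (simp add: right_submodule_def)
    have "{x \<in> carrier X. u x \<in> K} = carrier X"
      using K(2) S by (intro gen right_submodule_vimage[OF rX Y u K(1)]) auto
    then show "u ` carrier X \<subseteq> K" by auto
  qed
  then show ?thesis
    unfolding fg_module_iff
    using right_module_submodule[OF Y right_submodule_image[OF rX Y u]] S
    by (auto intro!: exI[of _ "u ` S"])
qed

section \<open>Direct sums\<close>

lemma dsum_simps [simp]:
  "carrier (dsum M N) = carrier M \<times> carrier N"
  "zero (dsum M N) = (\<zero>\<^bsub>M\<^esub>, \<zero>\<^bsub>N\<^esub>)"
  "add (dsum M N) (x, y) (x', y') = (x \<oplus>\<^bsub>M\<^esub> x', y \<oplus>\<^bsub>N\<^esub> y')"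
  "smult (dsum M N) a (x, y) = (a \<odot>\<^bsub>M\<^esub> x, a \<odot>\<^bsub>N\<^esub> y)"
  by (simp_all add: dsum_def)

lemma right_module_dsum:
  assumes "right_module L M" "right_module L N"
  shows "right_module L (dsum M N)"
proof -
  interpret M: right_module L M by fact
  interpret N: right_module L N by fact
  have "\<exists>y\<in>carrier (dsum M N). y \<oplus>\<^bsub>dsum M N\<^esub> x = \<zero>\<^bsub>dsum M N\<^esub>"
    if "x \<in> carrier (dsum M N)" for x
    using that by (intro bexI[of _ "(\<ominus>\<^bsub>M\<^esub> fst x, \<ominus>\<^bsub>N\<^esub> snd x)"]) (auto simp: M.M.l_neg N.M.l_neg)
  then interpret D: abelian_group "dsum M N"
    by (intro abelian_groupI) (auto simp: M.M.a_ac N.M.a_ac)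
  show ?thesis
    by unfold_locales
      (auto simp: M.smult_l_distr M.smult_r_distr M.smult_assoc M.smult_one M.smult_closed
        N.smult_l_distr N.smult_r_distr N.smult_assoc N.smult_one N.smult_closed)
qed

lemma mod_hom_dsum_inl:
  assumes "right_module L N"
  shows "(\<lambda>x. (x, \<zero>\<^bsub>N\<^esub>)) \<in> mod_hom L M (dsum M N)"
proof -
  interpret N: right_module L N by fact
  show ?thesis by (rule mod_homI) (auto simp: N.smult_zero_right)
qed

lemma mod_hom_dsum_inr:
  assumes "right_module L M"
  shows "(\<lambda>y. (\<zero>\<^bsub>M\<^esub>, y)) \<in> mod_hom L N (dsum M N)"
proof -
  interpret M: right_module L M by fact
  show ?thesis by (rule mod_homI) (auto simp: M.smult_zero_right)
qed

lemma mod_hom_pair: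
  assumes u: "u \<in> mod_hom L A M" and v: "v \<in> mod_hom L A N"
  shows "(\<lambda>x. (u x, v x)) \<in> mod_hom L A (dsum M N)"
  by (rule mod_homI) (auto simp: mod_hom_simps[OF u] mod_hom_simps[OF v])

lemma mod_hom_const_zero:
  assumes "right_module L N"
  shows "(\<lambda>_. \<zero>\<^bsub>N\<^esub>) \<in> mod_hom L M N"
proof -
  interpret N: right_module L N by fact
  show ?thesis by (rule mod_homI) (auto simp: N.smult_zero_right)
qed

lemma mod_hom_row_map:
  assumes "right_module L K" and u: "u \<in> mod_hom L M K" and v: "v \<in> mod_hom L N K"
  shows "row_map K u v \<in> mod_hom L (dsum M N) K"
proof -
  interpret K: right_module L K by fact
  show ?thesis
    by (rule mod_homI)
      (auto simp: row_map_def mod_hom_simps[OF u] mod_hom_simps[OF v] K.M.a_ac K.smult_r_distr)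
qed

text \<open>Embed the generators of both summands. The preimages of \<open>K\<close> under the two
  inclusions are submodules containing \<open>S\<close> and \<open>T\<close>, so \<open>K\<close>
  contains both summands and therefore their sums.\<close>

lemma fg_module_dsum:
  assumes M: "fg_module L M" and N: "fg_module L N"
  shows "fg_module L (dsum M N)"
proof -
  note rM = fg_module_right_module[OF M] and rN = fg_module_right_module[OF N]
  note rD = right_module_dsum[OF rM rN]
  interpret M: right_module L M by (rule rM)
  interpret N: right_module L N by (rule rN)
  obtain S where S: "S \<subseteq> carrier M" "finite S"
    and genS: "\<And>K. right_submodule L M K \<Longrightarrow> S \<subseteq> K \<Longrightarrow> K = carrier M"
    using M by (auto simp: fg_module_iff)
  obtain T where T: "T \<subseteq> carrier N" "finite T"
    and genT: "\<And>K. right_submodule L N K \<Longrightarrow> T \<subseteq> K \<Longrightarrow> K = carrier N"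
    using N by (auto simp: fg_module_iff)
  define G where "G = (\<lambda>x. (x, \<zero>\<^bsub>N\<^esub>)) ` S \<union> (\<lambda>y. (\<zero>\<^bsub>M\<^esub>, y)) ` T"
  have "K = carrier (dsum M N)" if K: "right_submodule L (dsum M N) K" "G \<subseteq> K" for K
  proof
    show "K \<subseteq> carrier (dsum M N)" using K by (simp add: right_submodule_def)
    have 1: "{x \<in> carrier M. (x, \<zero>\<^bsub>N\<^esub>) \<in> K} = carrier M"
      using K(2) S
      by (intro genS right_submodule_vimage[OF rM rD mod_hom_dsum_inl[OF rN] K(1)])
        (auto simp: G_def)
    have 2: "{y \<in> carrier N. (\<zero>\<^bsub>M\<^esub>, y) \<in> K} = carrier N"
      using K(2) T
      by (intro genT right_submodule_vimage[OF rN rD mod_hom_dsum_inr[OF rM] K(1)])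
        (auto simp: G_def)
    show "carrier (dsum M N) \<subseteq> K"
    proof clarsimp
      fix x y assume xy: "x \<in> carrier M" "y \<in> carrier N"
      then have "(x, \<zero>\<^bsub>N\<^esub>) \<oplus>\<^bsub>dsum M N\<^esub> (\<zero>\<^bsub>M\<^esub>, y) \<in> K"
        using 1 2 K(1) unfolding right_submodule_def by blast
      then show "(x, y) \<in> K" using xy by simp
    qed
  qed
  moreover have "G \<subseteq> carrier (dsum M N)" "finite G" using S T by (auto simp: G_def)
  ultimately show ?thesis unfolding fg_module_iff using rD by blast
qed

section \<open>Projective modules\<close>

lemma projective_fg_module: "projective L P \<Longrightarrow> fg_module L P"
  by (simp add: projective_def)

text \<open>\<open>projective\<close> tests lifting only against modules over
  \<open>'a univ\<close>. Here the lifting property is extended to all carrier types: replace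
  \<open>X\<close> and \<open>Y\<close> by isomorphic copies \<open>X'\<close> and
  \<open>Y'\<close>, lift there, and return along the inverse of \<open>i\<close>.\<close>

lemma projective_lift:
  fixes X :: "('a, 'x) module" and Y :: "('a, 'y) module"
  assumes P: "projective L P" and X: "fg_module L X" and Y: "fg_module L Y"
    and p: "p \<in> mod_epi L X Y" and q: "q \<in> mod_hom L P Y"
  obtains r where "r \<in> mod_hom L P X" "\<And>x. x \<in> carrier P \<Longrightarrow> p (r x) = q x"
proof -
  obtain X' :: "('a, 'a univ) module" and i where X': "fg_module L X'"
    and i: "i \<in> mod_hom L X X'" "bij_betw i (carrier X) (carrier X')"
    using fg_module_iso_universe[OF X] by blast
  obtain Y' :: "('a, 'a univ) module" and j where Y': "fg_module L Y'"
    and j: "j \<in> mod_hom L Y Y'" "bij_betw j (carrier Y) (carrier Y')"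
    using fg_module_iso_universe[OF Y] by blast
  define i' where "i' = inv_into (carrier X) i"
  have i': "i' \<in> mod_hom L X' X" unfolding i'_def
    using X i by (intro mod_hom_inv_into) (auto intro: fg_module_right_module)
  have i'_im: "i' ` carrier X' = carrier X"
    unfolding i'_def using bij_betw_inv_into[OF i(2)] by (simp add: bij_betw_def)
  have ph: "p \<in> mod_hom L X Y" and p_im: "p ` carrier X = carrier Y"
    using p by (auto simp: mod_epi_def)
  \<comment> \<open>The epimorphism \<open>p\<close> conjugated by the isomorphisms; it stays onto
    because \<open>i'\<close>, \<open>p\<close> and \<open>j\<close> all are.\<close>
  have "j \<circ> (p \<circ> i') \<in> mod_hom L X' Y'" by (intro mod_hom_comp[OF _ j(1)] mod_hom_comp[OF i' ph])
  moreover have "(j \<circ> (p \<circ> i')) ` carrier X' = carrier Y'"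
    using j(2) unfolding image_comp[symmetric] i'_im p_im by (simp add: bij_betw_def)
  ultimately have "j \<circ> (p \<circ> i') \<in> mod_epi L X' Y'" by (simp add: mod_epi_def)
  moreover have jq: "j \<circ> q \<in> mod_hom L P Y'" by (rule mod_hom_comp[OF q j(1)])
  ultimately have "\<exists>r\<in>mod_hom L P X'. \<forall>x\<in>carrier P. (j \<circ> (p \<circ> i')) (r x) = (j \<circ> q) x"
    using P X' Y' unfolding projective_def by blast
  then obtain r where r: "r \<in> mod_hom L P X'"
    and eq: "\<And>x. x \<in> carrier P \<Longrightarrow> j (p (i' (r x))) = j (q x)" by auto
  \<comment> \<open>The equation obtained over the copies still carries \<open>j\<close> on both
    sides; \<open>j\<close> is injective, so it cancels.\<close>
  have "p (i' (r x)) = q x" if "x \<in> carrier P" for x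
    using eq[OF that] that j(2) r q i' ph
    by (intro inj_onD[of j "carrier Y"]) (auto simp: bij_betw_def mod_hom_closed)
  then show thesis using mod_hom_comp[OF r i'] that by (metis comp_apply)
qed

text \<open>Restrict \<open>q\<close> to the two summands, lift each restriction, and recombine the
  lifts as the row map \<open>[r1 r2]\<close>.\<close>

lemma projective_dsum:
  assumes P: "projective L P" and Q: "projective L Q"
  shows "projective L (dsum P Q)"
  unfolding projective_def
proof (intro conjI allI impI ballI)
  note fgP = projective_fg_module[OF P] and fgQ = projective_fg_module[OF Q]
  note rP = fg_module_right_module[OF fgP] and rQ = fg_module_right_module[OF fgQ]
  interpret P: right_module L P by (rule rP)
  interpret Q: right_module L Q by (rule rQ)
  show "fg_module L (dsum P Q)" by (rule fg_module_dsum[OF fgP fgQ])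
  fix X Y :: "('a, 'a univ) module" and p q
  assume XY: "fg_module L X \<and> fg_module L Y"
    and p: "p \<in> mod_epi L X Y" and q: "q \<in> mod_hom L (dsum P Q) Y"
  have ph: "p \<in> mod_hom L X Y" using p by (simp add: mod_epi_def)
  obtain r1 where r1: "r1 \<in> mod_hom L P X" "\<And>x. x \<in> carrier P \<Longrightarrow> p (r1 x) = q (x, \<zero>\<^bsub>Q\<^esub>)"
    using projective_lift[OF P _ _ p mod_hom_comp[OF mod_hom_dsum_inl[OF rQ] q]] XY by auto
  obtain r2 where r2: "r2 \<in> mod_hom L Q X" "\<And>y. y \<in> carrier Q \<Longrightarrow> p (r2 y) = q (\<zero>\<^bsub>P\<^esub>, y)"
    using projective_lift[OF Q _ _ p mod_hom_comp[OF mod_hom_dsum_inr[OF rP] q]] XY by auto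
  have "p (row_map X r1 r2 z) = q z" if z: "z \<in> carrier (dsum P Q)" for z
  proof -
    obtain x y where xy: "z = (x, y)" "x \<in> carrier P" "y \<in> carrier Q" using z by auto
    have "p (row_map X r1 r2 z) = q (x, \<zero>\<^bsub>Q\<^esub>) \<oplus>\<^bsub>Y\<^esub> q (\<zero>\<^bsub>P\<^esub>, y)"
      using xy r1 r2 by (simp add: row_map_def mod_hom_add[OF ph] mod_hom_closed)
    also have "\<dots> = q z"
      using xy by (simp flip: mod_hom_add[OF q])
    finally show ?thesis .
  qed
  then show "\<exists>r\<in>mod_hom L (dsum P Q) X. \<forall>x\<in>carrier (dsum P Q). p (r x) = q x"
    using mod_hom_row_map[OF _ r1(1) r2(1)] XY fg_module_right_module by blast
qed

text \<open>Lifting along a map that need not be onto: shrinking the target to the image of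
  \<open>u\<close> makes \<open>u\<close> an epimorphism, and this image is finitely generated
  because \<open>X\<close> is. It will be applied to \<open>f\<close>, whose image is the kernel of
  \<open>\<sigma>\<close>.\<close>

lemma projective_lift_image:
  assumes A: "projective L A" and X: "fg_module L X" and Y: "right_module L Y"
    and u: "u \<in> mod_hom L X Y" and v: "v \<in> mod_hom L A Y" "v ` carrier A \<subseteq> u ` carrier X"
  obtains k where "k \<in> mod_hom L A X" "\<And>x. x \<in> carrier A \<Longrightarrow> u (k x) = v x"
proof (rule projective_lift[OF A X fg_module_image[OF X Y u]])
  show "u \<in> mod_epi L X (Y\<lparr>carrier := u ` carrier X\<rparr>)"
    using u by (auto simp: mod_epi_def mod_hom_def hom_def)
  show "v \<in> mod_hom L A (Y\<lparr>carrier := u ` carrier X\<rparr>)"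
    using v by (auto simp: mod_hom_def hom_def)
qed (use that in blast)

section \<open>The approximation\<close>

theorem proposition3p3:
  fixes R :: "'r ring" and L :: "'a ring" and \<phi> :: "'r \<Rightarrow> 'a"
    and N :: "('a, 'n) module" and M :: "('a, 'm) module" and g :: "'n \<Rightarrow> 'm"
    and P1 :: "('a, 'p1) module" and P0 :: "('a, 'p0) module"
    and f :: "'p1 \<Rightarrow> 'p0" and \<sigma> :: "'p0 \<Rightarrow> 'm"
    and Q :: "('a, 'q) module" and e :: "'q \<Rightarrow> 'n"
    and U :: "('a, 'u) module" and h :: "'u \<Rightarrow> 'n" and d :: "'u \<Rightarrow> 'p0" and e' :: "'q \<Rightarrow> 'u"
  assumes "artin_algebra R L \<phi>"
    and "H_obj L \<lparr>src = N, tgt = M, arr = g\<rparr>"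
    and "projective_presentation L P1 P0 M f \<sigma>"
    and "projective L Q" and "e \<in> mod_epi L Q N"
    and "is_pullback L N P0 M g \<sigma> U h d"
    and "e' \<in> mod_hom L Q U" and "\<forall>x\<in>carrier Q. h (e' x) = e x"
  shows "right_P_approximation TYPE('x) TYPE('y) L
           \<lparr>src = dsum P1 Q, tgt = P0, arr = row_map P0 f (d \<circ> e')\<rparr>
           \<lparr>src = N, tgt = M, arr = g\<rparr>
           (row_map N (\<lambda>_. \<zero>\<^bsub>N\<^esub>) e, \<sigma>)"
proof -
  from assms(2) have N: "fg_module L N" and M: "fg_module L M" and g: "g \<in> mod_hom L N M"
    by (auto simp: H_obj_def)
  from assms(3) have P1: "projective L P1" and P0: "projective L P0" and f: "f \<in> mod_hom L P1 P0"
    and \<sigma>epi: "\<sigma> \<in> mod_epi L P0 M" and ker: "f ` carrier P1 = a_kernel P0 M \<sigma>"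
    by (auto simp: projective_presentation_def)
  from assms(6) have d: "d \<in> mod_hom L U P0" and comm: "\<And>u. u \<in> carrier U \<Longrightarrow> \<sigma> (d u) = g (h u)"
    by (auto simp: is_pullback_def)
  note fg1 = projective_fg_module[OF P1] and fg0 = projective_fg_module[OF P0]
  note Q = assms(4) and e' = assms(7)
  have e: "e \<in> mod_hom L Q N" using assms(5) by (simp add: mod_epi_def)
  have \<sigma>: "\<sigma> \<in> mod_hom L P0 M" using \<sigma>epi by (simp add: mod_epi_def)
  interpret N: right_module L N by (rule fg_module_right_module[OF N])
  interpret M: right_module L M by (rule fg_module_right_module[OF M])
  interpret P0: right_module L P0 by (rule fg_module_right_module[OF fg0])
  have rN: "right_module L N" and r0: "right_module L P0" by unfold_locales
  have rM: "right_module L M" by unfold_locales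
  have de: "d \<circ> e' \<in> mod_hom L Q P0" by (rule mod_hom_comp[OF e' d])
  \<comment> \<open>The commuting square of the pullback together with
    \<open>h e' = e\<close>.\<close>
  have \<sigma>de: "\<sigma> (d (e' y)) = g (e y)" if "y \<in> carrier Q" for y
    using that assms(8) comm mod_hom_closed[OF e'] by simp
  have \<sigma>f: "\<sigma> (f x) = \<zero>\<^bsub>M\<^esub>" if "x \<in> carrier P1" for x
    using ker that by (auto simp: a_kernel_def' set_eq_iff)
  have g0: "g \<zero>\<^bsub>N\<^esub> = \<zero>\<^bsub>M\<^esub>" by (rule mod_hom_zero[OF rN rM g])
  let ?D = "\<lparr>src = dsum P1 Q, tgt = P0, arr = row_map P0 f (d \<circ> e')\<rparr>"
  have D: "P_obj L ?D"
    using projective_dsum[OF P1 Q] P0 fg0 mod_hom_row_map[OF r0 f de]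
    by (simp add: P_obj_def H_obj_def projective_fg_module)
  \<comment> \<open>The square commutes since
    \<open>\<sigma> (f x + d (e' y)) = 0 + g (e y)\<close>, while \<open>[0 e]\<close> sends
    \<open>(x, y)\<close> to \<open>e y\<close>.\<close>
  have \<pi>: "(row_map N (\<lambda>_. \<zero>\<^bsub>N\<^esub>) e, \<sigma>) \<in> H_hom L ?D \<lparr>src = N, tgt = M, arr = g\<rparr>"
    using mod_hom_row_map[OF rN mod_hom_const_zero[OF rN] e] \<sigma>
    by (auto simp: H_hom_def row_map_def mod_hom_add[OF \<sigma>] mod_hom_closed[OF f] \<sigma>f \<sigma>de
        mod_hom_closed[OF de, simplified] mod_hom_closed[OF e] mod_hom_closed[OF g])
  \<comment> \<open>The carrier types of \<open>T\<close> are arbitrary, which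
    \<open>projective_lift\<close> allows.\<close>
  have "\<exists>\<theta>\<in>H_hom L T ?D.
      (\<forall>x\<in>carrier (src T). row_map N (\<lambda>_. \<zero>\<^bsub>N\<^esub>) e (fst \<theta> x) = s1 x) \<and>
      (\<forall>y\<in>carrier (tgt T). \<sigma> (snd \<theta> y) = s2 y)"
    if T: "P_obj L T" and s: "(s1, s2) \<in> H_hom L T \<lparr>src = N, tgt = M, arr = g\<rparr>"
    for T :: "('a, 'x, 'y) mor" and s1 s2
  proof -
    from T have A: "projective L (src T)" and B: "projective L (tgt T)"
      and t: "arr T \<in> mod_hom L (src T) (tgt T)" by (auto simp: P_obj_def H_obj_def)
    from s have s1: "s1 \<in> mod_hom L (src T) N" and s2: "s2 \<in> mod_hom L (tgt T) M"
      and sq: "\<And>x. x \<in> carrier (src T) \<Longrightarrow> s2 (arr T x) = g (s1 x)" by (auto simp: H_hom_def)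
    obtain w where w: "w \<in> mod_hom L (tgt T) P0" "\<And>y. y \<in> carrier (tgt T) \<Longrightarrow> \<sigma> (w y) = s2 y"
      using projective_lift[OF B fg0 M \<sigma>epi s2] by blast
    obtain r where r: "r \<in> mod_hom L (src T) Q" "\<And>x. x \<in> carrier (src T) \<Longrightarrow> e (r x) = s1 x"
      using projective_lift[OF A projective_fg_module[OF Q] N assms(5) s1] by blast
    let ?wt = "w \<circ> arr T" and ?der = "(d \<circ> e') \<circ> r"
    \<comment> \<open>The defect of \<open>r\<close> and \<open>w\<close>: without a component in
      \<open>P1\<close>, the square from \<open>T\<close> to the approximating object would commute
      only up to \<open>?v\<close>.\<close>
    let ?v = "\<lambda>x. ?wt x \<ominus>\<^bsub>P0\<^esub> ?der x"
    have wt: "?wt \<in> mod_hom L (src T) P0" by (rule mod_hom_comp[OF t w(1)])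
    have der: "?der \<in> mod_hom L (src T) P0" by (rule mod_hom_comp[OF r(1) de])
    have v: "?v \<in> mod_hom L (src T) P0" by (rule P0.mod_hom_diff[OF wt der])
    \<comment> \<open>Homomorphisms are known to respect sums, so the difference \<open>?v\<close>
      is always used through this equation.\<close>
    have split: "?v x \<oplus>\<^bsub>P0\<^esub> ?der x = ?wt x" if x: "x \<in> carrier (src T)" for x
      using mod_hom_closed[OF wt x] mod_hom_closed[OF der x]
      by (simp add: P0.M.minus_eq P0.M.a_assoc P0.M.l_neg)
    have "?v x \<in> f ` carrier P1" if x: "x \<in> carrier (src T)" for x
    proof -
      note vx = mod_hom_closed[OF v x] and dx = mod_hom_closed[OF der x]
      have "\<sigma> (?v x) \<oplus>\<^bsub>M\<^esub> \<sigma> (?der x) = \<sigma> (?wt x)"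
        by (simp only: split[OF x] flip: mod_hom_add[OF \<sigma> vx dx])
      \<comment> \<open>Both sides equal \<open>g (s1 x)\<close>: on the left
        \<open>\<sigma> w = s2\<close> and the square of the given morphism apply, on the right
        \<open>\<sigma> d e' = g e\<close> and \<open>e r = s1\<close>.\<close>
      also have "\<dots> = \<sigma> (?der x)"
        using x by (simp add: w(2) mod_hom_closed[OF t] sq \<sigma>de mod_hom_closed[OF r(1)] r(2))
      finally have "\<sigma> (?v x) = \<zero>\<^bsub>M\<^esub>"
        using mod_hom_closed[OF \<sigma> vx] mod_hom_closed[OF \<sigma> dx] M.M.add.r_cancel_one by blast
      then show ?thesis using vx by (simp add: ker a_kernel_def')
    qed
    then obtain k where k: "k \<in> mod_hom L (src T) P1" "\<And>x. x \<in> carrier (src T) \<Longrightarrow> f (k x) = ?v x"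
      using projective_lift_image[OF A fg1 r0 f v] by blast
    \<comment> \<open>The square now commutes:
      \<open>f k + d e' r = ?v + d e' r = w t\<close>.\<close>
    have "((\<lambda>x. (k x, r x)), w) \<in> H_hom L T ?D"
      using mod_hom_pair[OF k(1) r(1)] w(1) k(2) split by (auto simp: H_hom_def row_map_def)
    \<comment> \<open>The entry \<open>0\<close> of \<open>[0 e]\<close> kills \<open>k\<close>, so
      the correction does not disturb the first component, which is \<open>e r = s1\<close>.\<close>
    then show ?thesis
      using r(2) w(2) mod_hom_closed[OF s1] by (intro bexI) (auto simp: row_map_def)
  qed
  then show ?thesis
    unfolding right_P_approximation_def using assms(2) D \<pi> by auto
qed

end
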